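(* Let $G$ be a graph. 1. If $v\in V(G)$ is unlooped then $M_A(G^{v})=M_A(G)$. 2. If $v\in V(G)$ is a coloop of both $M_A(G)$ and $M_A(G^{v})$, then $M_A(G^{v})=M_A(G)$. 3. If $v\in V(G)$ is looped and not a coloop of one of $M_A(G),M_A(G^{v})$, then $v$ is a coloop of the other and $M_A(G^{v})\ncong M_A(G)$. More specifically, if $\{M_A(G),M_A(G^{v})\}=\{M_1,M_2\}$ with $v$ not a coloop of $M_1$, then $v$ is a coloop of $M_2$ and $M_2=(M_1-v)\oplus U_{1,1}(\{v\})$.
   Context: Graphs are finite and may have loops and parallel edges. $\mathcal{A}(G)$ is the symmetric $V(G)\times V(G)$ matrix over $GF(2)$ with $a_{vv}=1$ iff $v$ is looped and, for $v\ne w$, $a_{vw}=1$ iff $v,w$ are adjacent. The adjacency matroid $M_A(G)$ is the binary matroid on $V(G)$ whose circuits are the minimal nonempty $S\subseteq V(G)$ such that the columns of $\mathcal{A}(G)$ indexed by $S$ are linearly dependent over $GF(2)$. The local complement $G^{v}$ is the looped simple graph (no parallel edges, at most one loop per vertex) obtained from $G$ by toggling the loop status of every neighbor $w\neq v$ of $v$ and toggling the adjacency status of every pair of distinct neighbors of $v$ (both different from $v$); all other adjacencies and loop statuses, including the loop status of $v$, are unchanged, and parallel edges are replaced by single edges. For a matroid $M$ on $V$ and $v\in V$: $v$ is a coloop of $M$ if it belongs to no circuit of $M$; the deletion $M-v$ is the matroid on $V\setminus\{v\}$ whose circuits are the circuits of $M$ not containing $v$. $\oplus$ is the direct sum of matroids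 on disjoint ground sets (the circuit families are united), and $U_{1,1}(\{v\})$ is the matroid on $\{v\}$ in which $v$ is a coloop. $\cong$ denotes isomorphism of matroids (some bijection of ground sets matching the circuits). *)

theory Defs
  imports Main "HOL-Library.Z2"
begin

section \<open>Graphs with loops and parallel edges\<close>

record ('a, 'e) multigraph =
  verts :: "'a set"
  edges :: "'e set"
  ends :: "'e \<Rightarrow> 'a set"

text \<open>An edge with a single end is a loop.\<close>

locale finite_multigraph =
  fixes G :: "('a, 'e) multigraph"
  assumes finite_verts: "finite (verts G)"
    and finite_edges: "finite (edges G)"
    and ends_subset: "e \<in> edges G \<Longrightarrow> ends G e \<subseteq> verts G"
    and card_ends: "e \<in> edges G \<Longrightarrow> card (ends G e) = 1 \<or> card (ends G e) = 2"

definition looped :: "('a, 'e) multigraph \<Rightarrow> 'a \<Rightarrow> bool" where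
  "looped G v \<longleftrightarrow> (\<exists>e\<in>edges G. ends G e = {v})"

text \<open>Adjacency relates distinct vertices only, so a looped vertex is not its own neighbour.\<close>

definition adjacent :: "('a, 'e) multigraph \<Rightarrow> 'a \<Rightarrow> 'a \<Rightarrow> bool" where
  "adjacent G v w \<longleftrightarrow> v \<noteq> w \<and> (\<exists>e\<in>edges G. ends G e = {v, w})"

text \<open>
  The edges of a local complement are the sets of their own ends, which rules out parallel edges.
  On truth values, \<open>\<noteq>\<close> is exclusive or.
\<close>

definition local_complement :: "('a, 'e) multigraph \<Rightarrow> 'a \<Rightarrow> ('a, 'a set) multigraph" where
  "local_complement G v =
    \<lparr>verts = verts G,
     edges = {{w} | w. w \<in> verts G \<and> (looped G w \<noteq> adjacent G v w)} \<union>
             {{x, y} | x y. x \<in> verts G \<and> y \<in> verts G \<and> x \<noteq> y \<and>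
                (adjacent G x y \<noteq> (adjacent G v x \<and> adjacent G v y))},
     ends = (\<lambda>e. e)\<rparr>"

lemma adjacent_sym: "adjacent G v w \<longleftrightarrow> adjacent G w v"
  by (auto simp: adjacent_def insert_commute)

lemma verts_local_complement [simp]: "verts (local_complement G v) = verts G"
  by (simp add: local_complement_def)

lemma looped_local_complement:
  assumes "w \<in> verts G"
  shows "looped (local_complement G v) w \<longleftrightarrow> (looped G w \<noteq> adjacent G v w)"
proof -
  have "looped (local_complement G v) w \<longleftrightarrow> {w} \<in> edges (local_complement G v)"
    by (simp add: looped_def local_complement_def)
  also have "\<dots> \<longleftrightarrow> (looped G w \<noteq> adjacent G v w)"
    using assms by (auto simp: local_complement_def)
  finally show ?thesis .
qed

lemma adjacent_local_complement:
  assumes "x \<in> verts G" "y \<in> verts G" "x \<noteq> y"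
  shows "adjacent (local_complement G v) x y \<longleftrightarrow>
    (adjacent G x y \<noteq> (adjacent G v x \<and> adjacent G v y))"
proof -
  have "adjacent (local_complement G v) x y \<longleftrightarrow> {x, y} \<in> edges (local_complement G v)"
    using assms by (simp add: adjacent_def local_complement_def)
  also have "\<dots> \<longleftrightarrow> (adjacent G x y \<noteq> (adjacent G v x \<and> adjacent G v y))"
    using assms adjacent_sym[of G x y] by (auto simp: local_complement_def doubleton_eq_iff)
  finally show ?thesis .
qed

lemma finite_multigraph_local_complement:
  assumes "finite_multigraph G"
  shows "finite_multigraph (local_complement G v)"
proof
  interpret finite_multigraph G by fact
  show "finite (verts (local_complement G v))"
    by (simp add: finite_verts)
  have "edges (local_complement G v) \<subseteq> Pow (verts G)"
    by (auto simp: local_complement_def)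
  then show "finite (edges (local_complement G v))"
    using finite_verts finite_subset by blast
  fix e assume "e \<in> edges (local_complement G v)"
  then show "ends (local_complement G v) e \<subseteq> verts (local_complement G v)"
    and "card (ends (local_complement G v) e) = 1 \<or> card (ends (local_complement G v) e) = 2"
    by (auto simp: local_complement_def)
qed


section \<open>Matroids given by their circuits\<close>

record 'a matroid =
  ground :: "'a set"
  circuits :: "'a set set"

locale finite_matroid =
  fixes M :: "'a matroid"
  assumes finite_ground: "finite (ground M)"
    and circuits_subset: "C \<in> circuits M \<Longrightarrow> C \<subseteq> ground M"
    and empty_not_circuit: "{} \<notin> circuits M"
    and circuits_incomparable: "C \<in> circuits M \<Longrightarrow> D \<in> circuits M \<Longrightarrow> C \<subseteq> D \<Longrightarrow> C = D"
    and circuit_elimination: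
      "C \<in> circuits M \<Longrightarrow> D \<in> circuits M \<Longrightarrow> C \<noteq> D \<Longrightarrow> x \<in> C \<inter> D \<Longrightarrow>
        \<exists>E\<in>circuits M. E \<subseteq> (C \<union> D) - {x}"

definition coloop :: "'a matroid \<Rightarrow> 'a \<Rightarrow> bool" where
  "coloop M v \<longleftrightarrow> v \<in> ground M \<and> (\<forall>C\<in>circuits M. v \<notin> C)"

definition deletion :: "'a matroid \<Rightarrow> 'a \<Rightarrow> 'a matroid" where
  "deletion M v = \<lparr>ground = ground M - {v}, circuits = {C \<in> circuits M. v \<notin> C}\<rparr>"

text \<open>Only meaningful when the two ground sets are disjoint.\<close>

definition direct_sum :: "'a matroid \<Rightarrow> 'a matroid \<Rightarrow> 'a matroid" where
  "direct_sum M N = \<lparr>ground = ground M \<union> ground N, circuits = circuits M \<union> circuits N\<rparr>"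

text \<open>The uniform matroid \<open>U\<^sub>1\<^sub>,\<^sub>1\<close> on a single element.\<close>

definition U11 :: "'a \<Rightarrow> 'a matroid" where
  "U11 v = \<lparr>ground = {v}, circuits = {}\<rparr>"

definition matroid_iso :: "'a matroid \<Rightarrow> 'b matroid \<Rightarrow> bool" where
  "matroid_iso M N \<longleftrightarrow>
    (\<exists>f. bij_betw f (ground M) (ground N) \<and> (\<lambda>C. f ` C) ` circuits M = circuits N)"


section \<open>The adjacency matroid\<close>

text \<open>Only the entries indexed by vertices matter.\<close>

definition adjacency_matrix :: "('a, 'e) multigraph \<Rightarrow> 'a \<Rightarrow> 'a \<Rightarrow> bit" where
  "adjacency_matrix G v w = of_bool (if v = w then looped G v else adjacent G v w)"

text \<open>
  The columns indexed by \<open>S\<close> are treated as an indexed family of vectors with entries indexed by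
  \<open>V\<close>: two equal columns at different indices are dependent.
\<close>

definition columns_dependent :: "'a set \<Rightarrow> ('a \<Rightarrow> 'a \<Rightarrow> bit) \<Rightarrow> 'a set \<Rightarrow> bool" where
  "columns_dependent V A S \<longleftrightarrow>
    (\<exists>c. (\<exists>s\<in>S. c s \<noteq> 0) \<and> (\<forall>v\<in>V. (\<Sum>s\<in>S. c s * A v s) = 0))"

definition adjacency_matroid :: "('a, 'e) multigraph \<Rightarrow> 'a matroid" where
  "adjacency_matroid G =
    \<lparr>ground = verts G,
     circuits = {S. S \<subseteq> verts G \<and> S \<noteq> {} \<and>
       columns_dependent (verts G) (adjacency_matrix G) S \<and>
       (\<forall>T. T \<subset> S \<and> T \<noteq> {} \<longrightarrow> \<not> columns_dependent (verts G) (adjacency_matrix G) T)}\<rparr>"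

lemma ground_adjacency_matroid [simp]: "ground (adjacency_matroid G) = verts G"
  by (simp add: adjacency_matroid_def)

lemma finite_matroid_adjacency_matroid:
  assumes "finite_multigraph G"
  shows "finite_matroid (adjacency_matroid G)"
proof -
  interpret finite_multigraph G by fact
  let ?V = "verts G" and ?A = "adjacency_matrix G"
  let ?dep = "columns_dependent ?V ?A"
  let ?M = "adjacency_matroid G"
  have circ: "S \<in> circuits ?M \<longleftrightarrow> S \<subseteq> ?V \<and> S \<noteq> {} \<and> ?dep S \<and> (\<forall>T. T \<subset> S \<and> T \<noteq> {} \<longrightarrow> \<not> ?dep T)"
    for S by (simp add: adjacency_matroid_def)
  have ground: "finite (ground ?M)" by (simp add: finite_verts)
  have subset: "C \<subseteq> ground ?M" if "C \<in> circuits ?M" for C using that by (simp add: circ)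
  have nonempty: "{} \<notin> circuits ?M" by (simp add: circ)
  have circ_dep: "?dep C" if "C \<in> circuits ?M" for C
    using that by (simp add: adjacency_matroid_def)
  have circ_min: "\<not> ?dep T" if "C \<in> circuits ?M" "T \<subset> C" "T \<noteq> {}" for C T
    using that by (simp add: adjacency_matroid_def)
  have incomparable: "C = D" if "C \<in> circuits ?M" "D \<in> circuits ?M" "C \<subseteq> D" for C D
  proof (rule ccontr)
    assume "C \<noteq> D"
    then have "C \<subset> D" using that(3) by blast
    moreover have "C \<noteq> {}" using that(1) nonempty by metis
    ultimately show False using circ_min[OF that(2)] circ_dep[OF that(1)] by metis
  qed
  have contains: "\<exists>E\<in>circuits ?M. E \<subseteq> S" if "S \<subseteq> ?V" "S \<noteq> {}" "?dep S" for S
  proof -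
    have "finite S" using that(1) finite_verts by (rule finite_subset)
    then show ?thesis using that
    proof (induction S rule: finite_psubset_induct)
      case (psubset S)
      show ?case
      proof (cases "S \<in> circuits ?M")
        case False
        then obtain T where T: "T \<subset> S" "T \<noteq> {}" "?dep T"
          using psubset.prems circ[of S] by metis
        then have "\<exists>E\<in>circuits ?M. E \<subseteq> T"
          using psubset.IH[of T] psubset.prems(1) by (metis psubset_imp_subset subset_trans)
        then show ?thesis using T by blast
      qed blast
    qed
  qed
  have full: "\<forall>v\<in>?V. (\<Sum>s\<in>C. ?A v s) = 0" if C: "C \<in> circuits ?M" for C
  proof -
    have fin: "finite C" using subset[OF C] finite_subset ground by blast
    obtain c where c: "\<exists>s\<in>C. c s \<noteq> 0" "\<forall>v\<in>?V. (\<Sum>s\<in>C. c s * ?A v s) = 0"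
      using circ_dep[OF C] unfolding columns_dependent_def by metis
    let ?T = "{s\<in>C. c s \<noteq> 0}"
    have sums: "(\<Sum>s\<in>?T. c s * ?A v s) = (\<Sum>s\<in>C. c s * ?A v s)" for v
      by (rule sum.mono_neutral_left) (use fin in auto)
    have "\<forall>v\<in>?V. (\<Sum>s\<in>?T. c s * ?A v s) = 0" using c(2) by (simp only: sums)
    moreover have "\<exists>s\<in>?T. c s \<noteq> 0" using c(1) by blast
    ultimately have "?dep ?T" unfolding columns_dependent_def by blast
    moreover have "?T \<noteq> {}" using c(1) by blast
    ultimately have "\<not> ?T \<subset> C" using circ_min[OF C, of ?T] by metis
    then have "?T = C" by blast
    have "c s = 1" if "s \<in> C" for s
    proof -
      have "s \<in> ?T" using \<open>?T = C\<close> that by (rule ssubst)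
      then show ?thesis by simp
    qed
    then have "(\<Sum>s\<in>C. c s * ?A v s) = (\<Sum>s\<in>C. ?A v s)" for v
      by (intro sum.cong) simp_all
    then show ?thesis using c(2) by (simp only:)
  qed
  have elimination: "\<exists>E\<in>circuits ?M. E \<subseteq> (C \<union> D) - {x}"
    if CD: "C \<in> circuits ?M" "D \<in> circuits ?M" "C \<noteq> D" "x \<in> C \<inter> D" for C D x
  proof -
    let ?S = "(C - D) \<union> (D - C)"
    have fin: "finite C" "finite D"
      using subset[OF CD(1)] subset[OF CD(2)] finite_subset ground by blast+
    have sum0: "(\<Sum>s\<in>?S. ?A v s) = 0" if "v \<in> ?V" for v
    proof -
      have 1: "(\<Sum>s\<in>C. ?A v s) = (\<Sum>s\<in>C - D. ?A v s) + (\<Sum>s\<in>C \<inter> D. ?A v s)"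
        using sum.Int_Diff[OF fin(1), of "?A v" D] by (metis add.commute)
      have 2: "(\<Sum>s\<in>D. ?A v s) = (\<Sum>s\<in>D - C. ?A v s) + (\<Sum>s\<in>C \<inter> D. ?A v s)"
        using sum.Int_Diff[OF fin(2), of "?A v" C] by (metis add.commute Int_commute)
      have "(\<Sum>s\<in>?S. ?A v s) = (\<Sum>s\<in>C - D. ?A v s) + (\<Sum>s\<in>D - C. ?A v s)"
        by (rule sum.union_disjoint) (use fin in auto)
      moreover have "a + e = 0" if "a + d = 0" "e + d = 0" for a d e :: bit
        using that by (cases a; cases d; cases e) auto
      ultimately show ?thesis using full[OF CD(1)] full[OF CD(2)] that 1 2 by metis
    qed
    have "?S \<noteq> {}" using CD(3) by blast
    moreover have "?dep ?S" unfolding columns_dependent_def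
      by (rule exI[of _ "\<lambda>_. 1"])
        (use sum0 \<open>?S \<noteq> {}\<close> in \<open>simp only: mult_1, blast intro: one_neq_zero\<close>)
    moreover have "?S \<subseteq> ?V" using subset[OF CD(1)] subset[OF CD(2)] by auto
    ultimately obtain E where "E \<in> circuits ?M" "E \<subseteq> ?S" using contains by blast
    then show ?thesis using CD(4) by blast
  qed
  show ?thesis
    by (rule finite_matroid.intro[OF ground subset nonempty incomparable elimination])
qed

end

theory Submission
  imports Defs
begin

text \<open>
  Over \<open>GF(2)\<close> a linear dependency among columns is just a set of columns with sum zero, so the
  circuits of the adjacency matroid are the minimal nonempty vertex sets in the kernel of the
  adjacency matrix \<open>A\<close> (lemma \<open>circuits_eq_minimal_kernel_sets\<close>), and everything can be read off
  from the kernel.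

  Let \<open>n\<close> be the indicator vector of the open neighbourhood of \<open>v\<close>. Local complementation at \<open>v\<close>
  replaces \<open>A\<close> by \<open>A + n n\<^sup>T\<close>. This leaves row \<open>v\<close> alone, and row \<open>v\<close> is \<open>n\<^sup>T\<close> except possibly in
  the entry at \<open>v\<close>. Hence, if \<open>v\<close> is unlooped or \<open>v \<notin> S\<close>, the equation of row \<open>v\<close> says
  \<open>n\<^sup>T S = 0\<close>, the other equations are unaffected by the change, and \<open>S\<close> lies in both kernels or in
  neither (lemma \<open>kernel_set_local_complement\<close>). So the two matroids agree for unlooped \<open>v\<close>, and
  in any case they have the same circuits avoiding \<open>v\<close>; this settles all claims once it is known
  that, for looped \<open>v\<close>, only one of the two kernels can contain a set through \<open>v\<close>.

  For that, suppose \<open>v\<close> is looped and lies in a kernel set \<open>S\<close> of \<open>A\<close> and in a kernel set \<open>T\<close> of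
  \<open>A + n n\<^sup>T\<close>. The equations of row \<open>v\<close> give \<open>n\<^sup>T S = n\<^sup>T T = 1\<close>, so \<open>A T = n (n\<^sup>T T) = n\<close>, and by
  the symmetry of \<open>A\<close> we get \<open>0 = (A S)\<^sup>T T = S\<^sup>T A T = S\<^sup>T n = 1\<close>, a contradiction (lemma
  \<open>not_both_kernels_through_looped\<close>).

  Finally, the matroids are not isomorphic in that case, because one has strictly more circuits.
\<close>

section \<open>Circuits as minimal kernel sets\<close>

definition kernel_set :: "('a, 'e) multigraph \<Rightarrow> 'a set \<Rightarrow> bool" where
  "kernel_set G S \<longleftrightarrow>
    S \<subseteq> verts G \<and> (\<forall>u\<in>verts G. (\<Sum>s\<in>S. adjacency_matrix G u s) = 0)"

text \<open>The support of a coefficient vector over \<open>GF(2)\<close> determines the vector.\<close>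

lemma columns_dependent_iff_zero_sum:
  assumes "finite S"
  shows "columns_dependent V A S \<longleftrightarrow> (\<exists>T\<subseteq>S. T \<noteq> {} \<and> (\<forall>u\<in>V. (\<Sum>s\<in>T. A u s) = 0))"
    (is "_ \<longleftrightarrow> ?R")
proof
  assume "columns_dependent V A S"
  then obtain c where c: "\<exists>s\<in>S. c s \<noteq> 0" "\<forall>u\<in>V. (\<Sum>s\<in>S. c s * A u s) = 0"
    unfolding columns_dependent_def by blast
  let ?T = "{s \<in> S. c s \<noteq> 0}"
  have "(\<Sum>s\<in>?T. A u s) = (\<Sum>s\<in>S. c s * A u s)" for u
    using assms by (intro sum.mono_neutral_cong_left) auto
  with c show ?R
    by (intro exI[of _ ?T]) auto
next
  assume ?R
  then obtain T where T: "T \<subseteq> S" "T \<noteq> {}" "\<forall>u\<in>V. (\<Sum>s\<in>T. A u s) = 0" by blast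
  have "(\<Sum>s\<in>S. of_bool (s \<in> T) * A u s) = (\<Sum>s\<in>T. A u s)" for u
    using assms T(1) by (intro sum.mono_neutral_cong_right) auto
  with T show "columns_dependent V A S"
    unfolding columns_dependent_def by (intro exI[of _ "\<lambda>s. of_bool (s \<in> T)"]) auto
qed

lemma circuits_eq_minimal_kernel_sets:
  assumes "finite (verts G)"
  shows "circuits (adjacency_matroid G) =
    {S. S \<noteq> {} \<and> kernel_set G S \<and> (\<forall>T. T \<subset> S \<and> T \<noteq> {} \<longrightarrow> \<not> kernel_set G T)}"
proof -
  have dep: "columns_dependent (verts G) (adjacency_matrix G) S \<longleftrightarrow>
      (\<exists>T\<subseteq>S. T \<noteq> {} \<and> kernel_set G T)" if "S \<subseteq> verts G" for S
    using columns_dependent_iff_zero_sum[OF finite_subset[OF that assms]] that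
    unfolding kernel_set_def by (metis subset_trans)
  let ?dep = "columns_dependent (verts G) (adjacency_matrix G)"
  have circ: "S \<in> circuits (adjacency_matroid G) \<longleftrightarrow>
      S \<subseteq> verts G \<and> S \<noteq> {} \<and> ?dep S \<and> (\<forall>T. T \<subset> S \<and> T \<noteq> {} \<longrightarrow> \<not> ?dep T)" for S
    by (simp add: adjacency_matroid_def)
  have "S \<in> circuits (adjacency_matroid G) \<longleftrightarrow>
      S \<noteq> {} \<and> kernel_set G S \<and> (\<forall>T. T \<subset> S \<and> T \<noteq> {} \<longrightarrow> \<not> kernel_set G T)"
    (is "_ \<longleftrightarrow> ?R") for S
  proof
    assume S: "S \<in> circuits (adjacency_matroid G)"
    then have sub: "S \<subseteq> verts G" and "?dep S"
      by (simp_all add: circ)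
    then obtain T where T: "T \<subseteq> S" "T \<noteq> {}" "kernel_set G T"
      using dep by blast
    have no_smaller: "\<not> kernel_set G U" if U: "U \<subset> S" "U \<noteq> {}" for U
    proof
      assume "kernel_set G U"
      moreover have "U \<subseteq> verts G" using U(1) sub by blast
      ultimately have "?dep U" using dep[of U] U(2) by blast
      with S U show False by (simp add: circ)
    qed
    then have "T = S" using T by blast
    with T no_smaller show ?R by blast
  next
    assume S: ?R
    then have sub: "S \<subseteq> verts G" by (simp add: kernel_set_def)
    have "?dep S" using dep[OF sub] S by blast
    moreover have "\<not> ?dep T" if T: "T \<subset> S" for T
    proof
      assume "?dep T"
      moreover have "T \<subseteq> verts G" using T sub by blast
      ultimately obtain U where "U \<subseteq> T" "U \<noteq> {}" "kernel_set G U"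
        using dep[of T] by blast
      with S T show False by blast
    qed
    ultimately show "S \<in> circuits (adjacency_matroid G)"
      using S sub by (simp add: circ)
  qed
  then show ?thesis by blast
qed


section \<open>The kernel under local complementation\<close>

lemma adjacency_matrix_sym: "adjacency_matrix G u w = adjacency_matrix G w u"
  by (simp add: adjacency_matrix_def adjacent_sym[of G u w])

lemma adjacency_matrix_local_complement:
  assumes "u \<in> verts G" "w \<in> verts G"
  shows "adjacency_matrix (local_complement G v) u w =
    adjacency_matrix G u w + of_bool (adjacent G v u) * of_bool (adjacent G v w)"
  using assms
  by (auto simp: adjacency_matrix_def looped_local_complement adjacent_local_complement)

lemma row_sum_local_complement:
  assumes "u \<in> verts G" "S \<subseteq> verts G"
  shows "(\<Sum>s\<in>S. adjacency_matrix (local_complement G v) u s) =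
    (\<Sum>s\<in>S. adjacency_matrix G u s) +
    of_bool (adjacent G v u) * (\<Sum>s\<in>S. of_bool (adjacent G v s))"
proof -
  have "(\<Sum>s\<in>S. adjacency_matrix (local_complement G v) u s) =
      (\<Sum>s\<in>S. adjacency_matrix G u s + of_bool (adjacent G v u) * of_bool (adjacent G v s))"
    using assms by (intro sum.cong) (auto simp: adjacency_matrix_local_complement)
  then show ?thesis
    by (simp only: sum.distrib sum_distrib_left)
qed

lemma not_adjacent_self [simp]: "\<not> adjacent G v v"
  by (simp add: adjacent_def)

lemma row_sum_local_complement_same_vertex:
  assumes "v \<in> verts G" "S \<subseteq> verts G"
  shows "(\<Sum>s\<in>S. adjacency_matrix (local_complement G v) v s) = (\<Sum>s\<in>S. adjacency_matrix G v s)"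
  using row_sum_local_complement[OF assms, of v] by simp

lemma row_sum_eq_neighbour_sum:
  assumes "finite S"
  shows "(\<Sum>s\<in>S. adjacency_matrix G v s) =
    (\<Sum>s\<in>S. of_bool (adjacent G v s)) + of_bool (looped G v \<and> v \<in> S)"
proof -
  have "(\<Sum>s\<in>S. adjacency_matrix G v s) =
      (\<Sum>s\<in>S. of_bool (adjacent G v s) + (if s = v then of_bool (looped G v) else 0))"
    by (intro sum.cong) (auto simp: adjacency_matrix_def)
  also have "\<dots> = (\<Sum>s\<in>S. of_bool (adjacent G v s)) + of_bool (looped G v \<and> v \<in> S)"
    by (simp only: sum.distrib sum.delta[OF assms]) (simp add: of_bool_def)
  finally show ?thesis .
qed

text \<open>
  In both graphs the equation of row \<open>v\<close> forces \<open>S\<close> to meet the neighbourhood of \<open>v\<close> in an even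
  number of vertices, and then the extra terms in all other rows cancel.
\<close>

lemma kernel_set_local_complement:
  assumes "finite (verts G)" "v \<in> verts G" "\<not> (looped G v \<and> v \<in> S)"
  shows "kernel_set (local_complement G v) S \<longleftrightarrow> kernel_set G S"
proof (cases "S \<subseteq> verts G")
  case True
  have row_v: "(\<Sum>s\<in>S. adjacency_matrix G v s) = (\<Sum>s\<in>S. of_bool (adjacent G v s))"
    using row_sum_eq_neighbour_sum[OF finite_subset[OF True assms(1)], of G v] assms(3) by simp
  show ?thesis
  proof (cases "(\<Sum>s\<in>S. adjacency_matrix G v s) = 0")
    case zero: True
    then show ?thesis
      using row_v row_sum_local_complement[OF _ True, of _ v] by (simp add: kernel_set_def)
  next
    case False
    then show ?thesis
      using row_sum_local_complement_same_vertex[OF assms(2) True] assms(2)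
      by (metis kernel_set_def verts_local_complement)
  qed
qed (simp add: kernel_set_def)

text \<open>Evaluating \<open>S\<^sup>T A T\<close> from the left gives 0, and from the right 1.\<close>

lemma not_both_kernels_through_looped:
  assumes "finite (verts G)" "v \<in> verts G" "looped G v"
    and S: "kernel_set G S" "v \<in> S"
    and T: "kernel_set (local_complement G v) T" "v \<in> T"
  shows False
proof -
  let ?A = "adjacency_matrix G" and ?n = "\<lambda>s. of_bool (adjacent G v s) :: bit"
  have sub: "S \<subseteq> verts G" "T \<subseteq> verts G"
    using S T by (auto simp: kernel_set_def)
  note fin = sub[THEN finite_subset, OF assms(1)]
  have zeroS: "(\<Sum>s\<in>S. ?A u s) = 0" if "u \<in> verts G" for u
    using S that by (simp add: kernel_set_def)
  have zeroT: "(\<Sum>t\<in>T. ?A u t) + ?n u * (\<Sum>t\<in>T. ?n t) = 0" if "u \<in> verts G" for u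
    using T that row_sum_local_complement[OF that sub(2), of v] by (simp add: kernel_set_def)
  have "(\<Sum>t\<in>T. ?A v t) = 0"
    using zeroT[OF assms(2)] by simp
  then have nT: "(\<Sum>t\<in>T. ?n t) = 1"
    using row_sum_eq_neighbour_sum[OF fin(2), of G v] assms(3) T(2)
    by (cases "\<Sum>t\<in>T. ?n t") simp_all
  have nS: "(\<Sum>s\<in>S. ?n s) = 1"
    using row_sum_eq_neighbour_sum[OF fin(1), of G v] zeroS[OF assms(2)] assms(3) S(2)
    by (cases "\<Sum>s\<in>S. ?n s") simp_all
  have AT: "(\<Sum>t\<in>T. ?A u t) = ?n u" if "u \<in> verts G" for u
    using zeroT[OF that] nT by (cases "\<Sum>t\<in>T. ?A u t"; cases "adjacent G v u") simp_all
  have "(\<Sum>s\<in>S. \<Sum>t\<in>T. ?A s t) = (\<Sum>s\<in>S. ?n s)"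
    using AT sub(1) by (intro sum.cong) auto
  moreover have "(\<Sum>s\<in>S. \<Sum>t\<in>T. ?A s t) = (\<Sum>t\<in>T. \<Sum>s\<in>S. ?A t s)"
    by (subst sum.swap) (simp only: adjacency_matrix_sym[of G])
  moreover have "\<dots> = 0"
    using zeroS sub(2) by (intro sum.neutral) auto
  ultimately show False
    using nS by simp
qed


section \<open>Comparing the two matroids\<close>

text \<open>
  The minimality of a circuit only concerns its subsets, so the restriction of the kernel to sets
  avoiding \<open>v\<close> determines the circuits avoiding \<open>v\<close>.
\<close>

lemma circuit_local_complement_iff:
  assumes "finite (verts G)" "v \<in> verts G" "\<not> (looped G v \<and> v \<in> C)"
  shows "C \<in> circuits (adjacency_matroid (local_complement G v)) \<longleftrightarrow>
    C \<in> circuits (adjacency_matroid G)"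
proof -
  have "kernel_set (local_complement G v) T \<longleftrightarrow> kernel_set G T" if "T \<subseteq> C" for T
    using kernel_set_local_complement[OF assms(1,2)] assms(3) that by blast
  then show ?thesis
    using assms(1) by (auto simp: circuits_eq_minimal_kernel_sets)
qed

lemma coloop_one_of_local_complement:
  assumes "finite (verts G)" "v \<in> verts G" "looped G v"
  shows "coloop (adjacency_matroid G) v \<or> coloop (adjacency_matroid (local_complement G v)) v"
proof (rule ccontr)
  assume "\<not> ?thesis"
  then obtain S T where "S \<in> circuits (adjacency_matroid G)" "v \<in> S"
    "T \<in> circuits (adjacency_matroid (local_complement G v))" "v \<in> T"
    using assms(2) by (auto simp: coloop_def)
  with assms show False
    using not_both_kernels_through_looped[of G v S T]
    by (simp add: circuits_eq_minimal_kernel_sets)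
qed

lemma matroid_iso_card_circuits:
  assumes "matroid_iso M N" "\<And>C. C \<in> circuits M \<Longrightarrow> C \<subseteq> ground M"
  shows "card (circuits M) = card (circuits N)"
proof -
  obtain f where f: "bij_betw f (ground M) (ground N)" "(\<lambda>C. f ` C) ` circuits M = circuits N"
    using assms(1) by (auto simp: matroid_iso_def)
  have "inj_on (\<lambda>C. f ` C) (circuits M)"
    using f(1) assms(2) by (meson PowI bij_betw_imp_inj_on inj_on_image_Pow inj_on_subset subsetI)
  then show ?thesis
    using f(2) card_image by metis
qed

text \<open>
  A matroid in which \<open>v\<close> is a coloop is determined by its ground set and the circuits avoiding
  \<open>v\<close>; it has fewer circuits than a finite matroid that shares these and has a further circuit
  through \<open>v\<close>.
\<close>

lemma coloop_vs_not_coloop: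
  assumes M: "finite_matroid M" and N: "finite_matroid N" and "ground M = ground N"
    and avoiding: "\<And>C. v \<notin> C \<Longrightarrow> C \<in> circuits M \<longleftrightarrow> C \<in> circuits N"
    and "v \<in> ground M" "\<not> coloop M v" "coloop N v"
  shows "N = direct_sum (deletion M v) (U11 v)"
    and "\<not> matroid_iso M N" and "\<not> matroid_iso N M"
proof -
  have circN: "circuits N = {C \<in> circuits M. v \<notin> C}"
    using avoiding assms(7) by (auto simp: coloop_def)
  show "N = direct_sum (deletion M v) (U11 v)"
    using circN assms(3,5) by (cases N) (auto simp: direct_sum_def deletion_def U11_def)
  have "circuits N \<subset> circuits M"
    using circN assms(5,6) by (auto simp: coloop_def)
  moreover have "finite (circuits M)"
    using finite_matroid.finite_ground[OF M] finite_matroid.circuits_subset[OF M]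
    by (meson PowI finite_Pow_iff finite_subset subsetI)
  ultimately have "card (circuits N) < card (circuits M)"
    by (rule psubset_card_mono[rotated])
  then show "\<not> matroid_iso M N" "\<not> matroid_iso N M"
    using matroid_iso_card_circuits finite_matroid.circuits_subset[OF M]
      finite_matroid.circuits_subset[OF N] by (metis less_irrefl)+
qed

theorem theorem19:
  fixes G :: "('a, 'e) multigraph" and v :: 'a
  assumes "finite_multigraph G" and "v \<in> verts G"
  shows
    "(\<not> looped G v \<longrightarrow>
        adjacency_matroid (local_complement G v) = adjacency_matroid G) \<and>
     (coloop (adjacency_matroid G) v \<and> coloop (adjacency_matroid (local_complement G v)) v \<longrightarrow>
        adjacency_matroid (local_complement G v) = adjacency_matroid G) \<and>
     (looped G v \<longrightarrow>
        (\<forall>M\<^sub>1 M\<^sub>2.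
           {adjacency_matroid G, adjacency_matroid (local_complement G v)} = {M\<^sub>1, M\<^sub>2} \<and>
           \<not> coloop M\<^sub>1 v \<longrightarrow>
             coloop M\<^sub>2 v \<and>
             \<not> matroid_iso (adjacency_matroid (local_complement G v)) (adjacency_matroid G) \<and>
             M\<^sub>2 = direct_sum (deletion M\<^sub>1 v) (U11 v)))"
proof -
  let ?G' = "local_complement G v"
  let ?M = "adjacency_matroid G" and ?M' = "adjacency_matroid ?G'"
  have fin: "finite (verts G)"
    using assms(1) by (rule finite_multigraph.finite_verts)
  note circuit_iff = circuit_local_complement_iff[OF fin assms(2)]
  have eqI: "?M' = ?M" if "circuits ?M' = circuits ?M"
    using that by (simp add: adjacency_matroid_def)
  have unlooped: "?M' = ?M" if "\<not> looped G v"
    using circuit_iff that by (intro eqI) blast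
  have coloops: "?M' = ?M" if "coloop ?M v" "coloop ?M' v"
    using circuit_iff that unfolding coloop_def by (intro eqI) blast
  have matroids: "finite_matroid ?M" "finite_matroid ?M'"
    by (intro finite_matroid_adjacency_matroid finite_multigraph_local_complement assms(1))+
  have looped: "coloop M\<^sub>2 v \<and> \<not> matroid_iso ?M' ?M \<and> M\<^sub>2 = direct_sum (deletion M\<^sub>1 v) (U11 v)"
    if "looped G v" "{?M, ?M'} = {M\<^sub>1, M\<^sub>2}" "\<not> coloop M\<^sub>1 v" for M\<^sub>1 M\<^sub>2
  proof -
    have one: "coloop ?M v \<or> coloop ?M' v"
      using coloop_one_of_local_complement[OF fin assms(2) that(1)] .
    from that(2) consider "M\<^sub>1 = ?M" "M\<^sub>2 = ?M'" | "M\<^sub>1 = ?M'" "M\<^sub>2 = ?M"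
      by (auto simp: doubleton_eq_iff)
    then show ?thesis
    proof cases
      case 1
      then show ?thesis
        using coloop_vs_not_coloop[OF matroids(1,2), of v] circuit_iff one that(3) assms(2) by auto
    next
      case 2
      then show ?thesis
        using coloop_vs_not_coloop[OF matroids(2,1), of v] circuit_iff one that(3) assms(2) by auto
    qed
  qed
  show ?thesis
    using unlooped coloops looped by blast
qed

end
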